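(* For $n\ge 1$ let $\mathcal{E}_n(x)=\sum_{j=0}^{n-1}\left\langle {n\atop j}\right\rangle x^j$ be the $n$-th Eulerian polynomial, where $\left\langle {n\atop j}\right\rangle=\sum_{i=0}^j(-1)^i\binom{n+1}{i}(j+1-i)^n$ are the Eulerian numbers. For $n\ge2$ and $1\le m\le n-1$ let $\varsigma_m(n)$ denote the $m$-th zero of $\mathcal{E}_n$, the zeros (which are all negative) being ordered in decreasing size. Then for every positive integer $m$, $$\lim_{n\to\infty}\frac{\varsigma_m(n)}{-\left(\frac{m}{m+1}\right)^{n}}=1.$$
   Context: The Eulerian polynomial $\mathcal{E}_n$ has degree $n-1$ and $n-1$ simple negative zeros. *)

theory Defs
  imports Complex_Main "HOL-Computational_Algebra.Polynomial"
begin

definition eulerian :: "nat \<Rightarrow> nat \<Rightarrow> int" where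
  "eulerian n j = (\<Sum>i=0..j. (-1) ^ i * int (Suc n choose i) * (int j + 1 - int i) ^ n)"

text \<open>Meant for \<open>n \<ge> 1\<close>; for \<open>n = 0\<close> the sum is empty.\<close>

definition eulerian_poly :: "nat \<Rightarrow> real poly" where
  "eulerian_poly n = (\<Sum>j<n. monom (of_int (eulerian n j)) j)"

text \<open>
  The \<open>m\<close>-th zero (\<open>1 \<le> m \<le> n - 1\<close>, counted from 1) in decreasing order with respect
  to the order of the reals, so \<open>m = 1\<close> is the zero closest to 0. All zeros of the Eulerian
  polynomial are real and simple, so the set of its real zeros has exactly \<open>n - 1\<close> elements
  and listing it omits nothing. Outside the range of \<open>m\<close> the value is unspecified.
\<close>

definition eulerian_zero :: "nat \<Rightarrow> nat \<Rightarrow> real" where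
  "eulerian_zero m n = rev (sorted_list_of_set {x. poly (eulerian_poly n) x = 0}) ! (m - 1)"

end

theory Submission
  imports Defs "HOL-Analysis.Uniform_Limit"
begin

text \<open>
  For fixed \<open>j\<close> the \<open>j\<close>-th coefficient of the Eulerian polynomial grows like \<open>(j + 1) ^ n\<close>. At
  \<open>x = - s * r ^ n\<close> with \<open>r = m / (m + 1)\<close> the \<open>j\<close>-th term therefore has size about
  \<open>((j + 1) * r ^ j) ^ n * s ^ j\<close>, and \<open>(j + 1) * r ^ j\<close> attains its maximum \<open>q\<close> exactly at the two
  indices \<open>j = m - 1\<close> and \<open>j = m\<close>. By Tannery's theorem the value divided by \<open>q ^ n\<close> tends to
  \<open>(- s) ^ (m - 1) * (1 - s)\<close>, which changes sign at \<open>s = 1\<close>; this yields a zero near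
  \<open>- (k / (k + 1)) ^ n\<close> for each \<open>k \<le> m\<close>. There is no room for further zeros: the same estimate
  shows that the constant term dominates the \<open>m\<close>-th derivative on \<open>\<bar>x\<bar> \<le> 2 * r ^ n\<close>, so by Rolle's
  theorem there are at most \<open>m\<close> zeros in that range, and none is positive.
\<close>

section \<open>Eulerian numbers: recurrence, vanishing, sign and size\<close>

lemma eulerian_0_right [simp]: "eulerian n 0 = 1"
  by (simp add: eulerian_def)

text \<open>The alternating sums are matched by their bases \<open>j + 1 - i\<close>. After the term
  with base \<open>j + 2\<close> is split off, Pascal's rule and the absorption identity match the
  rest term by term. The recurrence makes vanishing and sign visible, which the alternating sum
  hides.\<close>

lemma eulerian_Suc_Suc:
  "eulerian (Suc n) (Suc j) =
     (int j + 2) * eulerian n (Suc j) + (int n - int j) * eulerian n j"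
proof -
  have term_eq: "(-1) ^ Suc i * int (Suc (Suc n) choose Suc i) * (int j + 1 - int i) ^ Suc n =
      (int j + 2) * ((-1) ^ Suc i * int (Suc n choose Suc i) * (int j + 1 - int i) ^ n) +
      (int n - int j) * ((-1) ^ i * int (Suc n choose i) * (int j + 1 - int i) ^ n)"
    if "i \<le> j" for i
  proof -
    have absorb: "(int i + 1) * int (Suc n choose Suc i) = (int n + 1 - int i) * int (Suc n choose i)"
    proof (cases "i \<le> n")
      case True
      have "Suc i * (Suc n choose Suc i) = (Suc n - i) * (Suc n choose i)"
        by (metis Suc_times_binomial_eq binomial_absorb_comp diff_Suc_1 mult.commute)
      then have "int (Suc i) * int (Suc n choose Suc i) = int (Suc n - i) * int (Suc n choose i)"
        by (metis of_nat_mult)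
      with True show ?thesis by (simp add: of_nat_diff algebra_simps)
    next
      case False
      then show ?thesis by (cases "i = Suc n") (auto simp: binomial_eq_0)
    qed
    have pascal: "int (Suc (Suc n) choose Suc i) = int (Suc n choose Suc i) + int (Suc n choose i)"
      by simp
    have "int (Suc (Suc n) choose Suc i) * (int j + 1 - int i) =
        (int j + 2) * int (Suc n choose Suc i) - (int n - int j) * int (Suc n choose i)"
      unfolding pascal using absorb by (simp only: algebra_simps)
    then have "((-1) ^ Suc i * (int j + 1 - int i) ^ n) *
        (int (Suc (Suc n) choose Suc i) * (int j + 1 - int i)) =
      ((-1) ^ Suc i * (int j + 1 - int i) ^ n) *
        ((int j + 2) * int (Suc n choose Suc i) - (int n - int j) * int (Suc n choose i))"
      by presburger
    then show ?thesis by (simp only: power_Suc algebra_simps)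
  qed
  have shift: "int (Suc j) + 1 - int (Suc i) = int j + 1 - int i" for i
    by simp
  have "eulerian (Suc n) (Suc j) = (int j + 2) ^ Suc n +
      (\<Sum>i=0..j. (-1) ^ Suc i * int (Suc (Suc n) choose Suc i) * (int j + 1 - int i) ^ Suc n)"
    unfolding eulerian_def sum.atLeast0_atMost_Suc_shift o_def shift by (simp add: add_ac)
  also have "\<dots> = (int j + 2) ^ Suc n +
      (\<Sum>i=0..j. (int j + 2) * ((-1) ^ Suc i * int (Suc n choose Suc i) * (int j + 1 - int i) ^ n) +
      (int n - int j) * ((-1) ^ i * int (Suc n choose i) * (int j + 1 - int i) ^ n))"
    by (intro arg_cong2[where f="(+)"] sum.cong term_eq refl) auto
  also have "\<dots> = (int j + 2) * ((int j + 2) ^ n +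
      (\<Sum>i=0..j. (-1) ^ Suc i * int (Suc n choose Suc i) * (int j + 1 - int i) ^ n)) +
      (int n - int j) * eulerian n j"
    unfolding eulerian_def by (simp only: sum.distrib sum_distrib_left distrib_left power_Suc add.assoc)
  also have "(int j + 2) ^ n +
      (\<Sum>i=0..j. (-1) ^ Suc i * int (Suc n choose Suc i) * (int j + 1 - int i) ^ n) = eulerian n (Suc j)"
    unfolding eulerian_def sum.atLeast0_atMost_Suc_shift o_def shift by (simp add: add_ac)
  finally show ?thesis .
qed

lemma eulerian_eq_0: "n \<le> j \<Longrightarrow> 1 \<le> j \<Longrightarrow> eulerian n j = 0"
proof (induction n arbitrary: j)
  case 0
  then have "eulerian 0 j = (\<Sum>i\<in>{0, 1}. (-1) ^ i * int (Suc 0 choose i))"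
    unfolding eulerian_def by (intro sum.mono_neutral_cong_right) (auto simp: binomial_eq_0)
  then show ?case by simp
next
  case (Suc n)
  then obtain k where k: "j = Suc k" by (cases j) auto
  \<comment> \<open>For \<open>k = n\<close> the factor vanishes. This also covers
    \<open>n = k = 0\<close>, where the Eulerian number is 1 and the induction hypothesis does not
    apply.\<close>
  have "(int n - int k) * eulerian n k = 0"
    using Suc k by (cases "k = n") auto
  then show ?case using Suc k by (simp add: eulerian_Suc_Suc)
qed

text \<open>The factor \<open>n - k\<close> in the recurrence is negative only for
  \<open>k > n\<close>, where the Eulerian number it multiplies is zero.\<close>

lemma eulerian_nonneg: "0 \<le> eulerian n j"
proof (induction n arbitrary: j)
  case 0
  then show ?case by (cases j) (simp_all add: eulerian_eq_0)
next
  case (Suc n)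
  show ?case
  proof (cases j)
    case (Suc k)
    show ?thesis
      using Suc.IH Suc by (cases "k \<le> n") (auto simp: eulerian_Suc_Suc eulerian_eq_0)
  qed simp
qed

text \<open>The triangle inequality, with the binomials summed over a whole row. The bound is crude
  by a factor exponential in \<open>n\<close>, but it is uniform in \<open>j\<close>, which the
  asymptotics for fixed \<open>j\<close> are not.\<close>

lemma eulerian_le: "eulerian n j \<le> 2 ^ Suc n * (int j + 1) ^ n"
proof -
  have "eulerian n j \<le> (\<Sum>i=0..j. int (Suc n choose i) * (int j + 1) ^ n)"
    unfolding eulerian_def
  proof (rule sum_mono)
    fix i assume "i \<in> {0..j}"
    then have "0 \<le> int j + 1 - int i" "int j + 1 - int i \<le> int j + 1" by auto
    then have "(int j + 1 - int i) ^ n \<le> (int j + 1) ^ n" "0 \<le> (int j + 1 - int i) ^ n"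
      by (auto intro: power_mono)
    then have "int (Suc n choose i) * (int j + 1 - int i) ^ n \<le> int (Suc n choose i) * (int j + 1) ^ n"
      "0 \<le> int (Suc n choose i) * (int j + 1 - int i) ^ n"
      by (auto intro: mult_left_mono)
    then show "(-1) ^ i * int (Suc n choose i) * (int j + 1 - int i) ^ n
        \<le> int (Suc n choose i) * (int j + 1) ^ n"
      by (cases "even i") auto
  qed
  also have "\<dots> = int (\<Sum>i=0..j. Suc n choose i) * (int j + 1) ^ n"
    by (simp add: sum_distrib_right)
  also have "(\<Sum>i=0..j. Suc n choose i) = (\<Sum>i\<in>{0..j} \<inter> {..Suc n}. Suc n choose i)"
    by (rule sum.mono_neutral_right) (auto simp: binomial_eq_0)
  also have "\<dots> \<le> (\<Sum>i\<le>Suc n. Suc n choose i)"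
    by (rule sum_mono2) auto
  also have "\<dots> = 2 ^ Suc n" by (rule choose_row_sum)
  finally show ?thesis by (simp add: mult_right_mono)
qed

section \<open>Asymptotics of the coefficients and of the tail\<close>

lemma binomial_times_power_tendsto_0:
  fixes x :: real
  assumes "0 \<le> x" "x < 1"
  shows "(\<lambda>n. real (Suc n choose i) * x ^ n) \<longlonglongrightarrow> 0"
proof -
  \<comment> \<open>Any \<open>y > 0\<close> with \<open>(1 + y) * x < 1\<close> would do: a single
    term of the expansion of \<open>(1 + y) ^ Suc n\<close> bounds the binomial coefficient by a
    constant times \<open>(1 + y) ^ n\<close>.\<close>
  define y where "y = (1 - x) / 2"
  have y: "0 < y" using assms by (simp add: y_def)
  have "0 < (1 - x) * (2 - x)" using assms by simp
  then have lt: "(1 + y) * x < 1" by (simp add: y_def field_simps)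
  have le: "real (Suc n choose i) * x ^ n \<le> (1 + y) / y ^ i * ((1 + y) * x) ^ n" for n
  proof -
    have "real (Suc n choose i) * y ^ i \<le> (1 + y) ^ Suc n"
    proof (cases "i \<le> Suc n")
      case True
      have "real (Suc n choose i) * y ^ i \<le> (\<Sum>k\<le>Suc n. real (Suc n choose k) * y ^ k)"
        using True y by (intro member_le_sum) auto
      also have "\<dots> = (1 + y) ^ Suc n"
        using binomial_ring[of y 1 "Suc n"] by (simp add: add.commute)
      finally show ?thesis .
    qed (use y in \<open>simp add: binomial_eq_0\<close>)
    then have "real (Suc n choose i) \<le> (1 + y) ^ Suc n / y ^ i"
      using y by (simp add: field_simps)
    then have "real (Suc n choose i) * x ^ n \<le> (1 + y) ^ Suc n / y ^ i * x ^ n"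
      using assms by (intro mult_right_mono) auto
    then show ?thesis by (simp add: power_mult_distrib)
  qed
  have lim: "(\<lambda>n. (1 + y) / y ^ i * ((1 + y) * x) ^ n) \<longlonglongrightarrow> 0"
    using lt y assms by (intro tendsto_mult_right_zero LIMSEQ_power_zero) auto
  show ?thesis
    by (rule tendsto_sandwich[OF _ _ tendsto_const lim])
      (use assms le in \<open>auto intro!: always_eventually\<close>)
qed

text \<open>In the defining sum the term \<open>i = 0\<close> has the largest base. Relative to it,
  each of the finitely many others is a binomial coefficient times the power of a ratio below
  1.\<close>

lemma eulerian_asymp: "(\<lambda>n. real_of_int (eulerian n j) / (real j + 1) ^ n) \<longlonglongrightarrow> 1"
proof -
  let ?t = "\<lambda>n i. (-1) ^ i * (real (Suc n choose i) * ((real j + 1 - real i) / (real j + 1)) ^ n)"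
  have "(\<lambda>n. \<Sum>i=0..j. ?t n i) \<longlonglongrightarrow> (\<Sum>i=0..j. if i = 0 then 1 else 0)"
  proof (rule tendsto_sum)
    fix i assume "i \<in> {0..j}"
    then show "(\<lambda>n. ?t n i) \<longlonglongrightarrow> (if i = 0 then 1 else 0)"
      by (cases "i = 0")
        (auto intro!: tendsto_mult_right_zero binomial_times_power_tendsto_0)
  qed
  moreover have "(\<Sum>i=0..j. ?t n i) = real_of_int (eulerian n j) / (real j + 1) ^ n" for n
    by (simp add: eulerian_def sum_divide_distrib power_divide mult.assoc)
  ultimately show ?thesis by simp
qed

text \<open>Tannery's theorem: outside \<open>S\<close> each normalised term tends to 0 by the exact
  growth rate of its coefficient, while the crude bound \<open>eulerian_le\<close> provides the
  domination.\<close>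

lemma eulerian_tail_tendsto_0:
  fixes r q c :: real
  assumes r: "0 < r" "r < 1" and q: "0 < q"
    and S: "\<And>j. j \<notin> S \<Longrightarrow> (real j + 1) * r ^ j < q"
  shows "(\<lambda>n. \<Sum>j\<in>{..<n} - S. real_of_int (eulerian n j) * c ^ j * (r ^ n) ^ j / q ^ n) \<longlonglongrightarrow> 0"
proof -
  let ?t = "\<lambda>j n. real_of_int (eulerian n j) * c ^ j * (r ^ n) ^ j / q ^ n"
  \<comment> \<open>Padding with zeros turns the finite sum, whose range depends on
    \<open>n\<close>, into a series over all \<open>j\<close>.\<close>
  define f where "f j n = (if j \<in> S \<or> n \<le> j then 0 else ?t j n)" for j n
  \<comment> \<open>For large \<open>j\<close> half of the decay of \<open>r ^ (n * j)\<close> absorbs the crude coefficient bound,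
    uniformly in \<open>n\<close>; the other half makes the dominating series geometric.\<close>
  define u where "u = sqrt r"
  have u: "0 < u" "u < 1" "r = u\<^sup>2" using r by (auto simp: u_def)
  have lim: "(f j) \<longlonglongrightarrow> 0" for j
  proof (cases "j \<in> S")
    case False
    define \<rho> where "\<rho> = (real j + 1) * r ^ j / q"
    have \<rho>: "0 \<le> \<rho>" "\<rho> < 1" using S[OF False] r q by (auto simp: \<rho>_def)
    have "(\<lambda>n. real_of_int (eulerian n j) / (real j + 1) ^ n * c ^ j * \<rho> ^ n) \<longlonglongrightarrow> 1 * c ^ j * 0"
      using \<rho> by (intro tendsto_intros eulerian_asymp LIMSEQ_power_zero) auto
    moreover have "real_of_int (eulerian n j) / (real j + 1) ^ n * c ^ j * \<rho> ^ n = ?t j n" for n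
      by (simp add: \<rho>_def power_divide power_mult_distrib mult.commute flip: power_mult)
    ultimately have "?t j \<longlonglongrightarrow> 0" by simp
    then show ?thesis
      by (rule Lim_transform_eventually)
        (rule eventually_mono[OF eventually_gt_at_top[of j]], use False in \<open>simp add: f_def\<close>)
  next
    case True
    then have "f j = (\<lambda>n. 0)" by (simp add: f_def fun_eq_iff)
    then show ?thesis by simp
  qed
  have "(\<lambda>j. 2 * ((real j + 1) * u ^ j)) \<longlonglongrightarrow> 2 * 0"
  proof (intro tendsto_mult tendsto_const)
    have "(\<lambda>j. real j * u ^ j + u ^ j) \<longlonglongrightarrow> 0 + 0"
      using u by (intro tendsto_add powser_times_n_limit_0 LIMSEQ_power_zero) auto
    then show "(\<lambda>j. (real j + 1) * u ^ j) \<longlonglongrightarrow> 0" by (simp add: distrib_right)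
  qed
  then have "\<forall>\<^sub>F j in sequentially. 2 * ((real j + 1) * u ^ j) < q / 2"
    by (rule order_tendstoD) (use q in simp)
  moreover have "(\<lambda>n. \<bar>c\<bar> * u ^ n) \<longlonglongrightarrow> \<bar>c\<bar> * 0"
    using u by (intro tendsto_intros LIMSEQ_power_zero) auto
  then have "\<forall>\<^sub>F n in sequentially. \<bar>c\<bar> * u ^ n < 1 / 2"
    by (intro order_tendstoD) auto
  ultimately have bound: "\<forall>\<^sub>F (j, n) in at_top \<times>\<^sub>F sequentially. norm (f j n) \<le> 2 * (1 / 2) ^ j"
    unfolding case_prod_unfold
  proof (rule eventually_prodI[THEN eventually_mono, rule_format])
    fix p :: "nat \<times> nat"
    obtain j n where p: "p = (j, n)" by fastforce
    assume "2 * ((real (fst p) + 1) * u ^ fst p) < q / 2 \<and> \<bar>c\<bar> * u ^ snd p < 1 / 2"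
    then have j: "2 * ((real j + 1) * u ^ j) / q \<le> 1" and n: "\<bar>c\<bar> * u ^ n \<le> 1 / 2"
      using q by (auto simp: p field_simps)
    have "norm (f j n) \<le> real_of_int (eulerian n j) * \<bar>c\<bar> ^ j * (r ^ n) ^ j / q ^ n"
      using r q eulerian_nonneg[of n j] by (auto simp: f_def abs_mult power_abs)
    also have "\<dots> \<le> (2 ^ Suc n * (real j + 1) ^ n) * \<bar>c\<bar> ^ j * (r ^ n) ^ j / q ^ n"
      using r q eulerian_le[of n j]
      by (intro divide_right_mono mult_right_mono)
        (auto simp flip: of_int_le_iff[where 'a = real])
    also have "\<dots> = 2 * (2 * ((real j + 1) * u ^ j) / q) ^ n * (\<bar>c\<bar> * u ^ n) ^ j"
      by (simp add: u(3) power_mult_distrib power_divide power2_eq_square mult_ac flip: power_mult)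
    also have "\<dots> \<le> 2 * 1 * (1 / 2) ^ j"
      using j n u q by (intro mult_mono power_mono power_le_one) auto
    finally show "norm (f (fst p) (snd p)) \<le> 2 * (1 / 2) ^ fst p" by (simp add: p)
  qed
  have "(\<lambda>n. \<Sum>j. f j n) \<longlonglongrightarrow> (\<Sum>j. 0)"
    using tannerys_theorem[OF lim bound] by (simp add: summable_mult summable_geometric)
  moreover have "(\<Sum>j. f j n) = (\<Sum>j\<in>{..<n} - S. ?t j n)" for n
  proof -
    have "(\<Sum>j. f j n) = (\<Sum>j\<in>{..<n} - S. f j n)"
      by (rule suminf_finite) (auto simp: f_def)
    then show ?thesis by (simp add: f_def)
  qed
  ultimately show ?thesis by simp
qed

section \<open>The Eulerian polynomial and its derivatives on the scale \<open>r ^ n\<close>\<close>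

lemma poly_eulerian_poly: "poly (eulerian_poly n) x = (\<Sum>j<n. real_of_int (eulerian n j) * x ^ j)"
  by (simp add: eulerian_poly_def poly_sum poly_monom)

lemma poly_eulerian_poly_pos:
  assumes "1 \<le> n" "0 \<le> x"
  shows "0 < poly (eulerian_poly n) x"
proof -
  have "real_of_int (eulerian n 0) * x ^ 0 \<le> poly (eulerian_poly n) x"
    unfolding poly_eulerian_poly using assms eulerian_nonneg
    by (intro member_le_sum) auto
  then show ?thesis by simp
qed

lemma finite_eulerian_poly_roots: "1 \<le> n \<Longrightarrow> finite {x. poly (eulerian_poly n) x = 0}"
  using poly_eulerian_poly_pos[of n 0] by (intro poly_roots_finite) auto

text \<open>The ratio of consecutive terms, \<open>(j + 2) * r / (j + 1)\<close>, exceeds 1 for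
  \<open>j + 1 < m\<close>, equals 1 at \<open>j = m - 1\<close> and is below 1 from
  \<open>j = m\<close> on. The value of \<open>r\<close> is the one that makes these two terms
  tie.\<close>

lemma peak_term:
  fixes m :: nat
  assumes "1 \<le> m"
  defines "r \<equiv> real m / real (m + 1)"
  shows "j \<notin> {m - 1, m} \<Longrightarrow> (real j + 1) * r ^ j < (real m + 1) * r ^ m"
    and "(real m + 1) * r ^ m = real m * r ^ (m - 1)"
proof -
  have r: "0 < r" using assms by simp
  have up: "(real i + 1) * r ^ i < (real (Suc i) + 1) * r ^ Suc i" if "Suc i < m" for i
  proof -
    have "real i + 1 < (real i + 2) * r"
      using that by (simp add: r_def field_simps)
    then show ?thesis using r by (simp add: add_ac)
  qed
  have down: "(real (Suc i) + 1) * r ^ Suc i < (real i + 1) * r ^ i" if "m \<le> i" for i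
  proof -
    have "(real i + 2) * r < real i + 1"
      using that by (simp add: r_def field_simps)
    then show ?thesis using r by (simp add: add_ac)
  qed
  show eq: "(real m + 1) * r ^ m = real m * r ^ (m - 1)"
  proof -
    have "(real m + 1) * r = real m" by (simp add: r_def field_simps)
    then show ?thesis
      using power_minus_mult[of m r] assms(1)
      by (metis less_eq_Suc_le One_nat_def mult.assoc mult.commute)
  qed
  show "(real j + 1) * r ^ j < (real m + 1) * r ^ m" if "j \<notin> {m - 1, m}"
  proof (cases "m < j")
    case True
    then have "Suc m \<le> j" by simp
    then show ?thesis
    proof (induction j rule: dec_induct)
      case (step i)
      then show ?case using down[of i] by linarith
    qed (use down[of m] in simp)
  next
    case False
    with that have "j < m - 1" by auto
    then have "(real j + 1) * r ^ j < (real (m - 1) + 1) * r ^ (m - 1)"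
    proof (induction j rule: strict_inc_induct)
      case (base i)
      then show ?case using up[of i] by simp
    next
      case (step i)
      then show ?case using up[of i] by linarith
    qed
    then show ?thesis using eq assms by (simp add: of_nat_diff)
  qed
qed

text \<open>After division by the \<open>n\<close>-th power of the peak value only the terms
  \<open>m - 1\<close> and \<open>m\<close> survive, with limits \<open>(- s) ^ (m - 1)\<close> and
  \<open>(- s) ^ m\<close>.\<close>

lemma eulerian_poly_near_zero:
  fixes m :: nat and s :: real
  assumes "1 \<le> m"
  defines "r \<equiv> real m / real (m + 1)"
  shows "(\<lambda>n. poly (eulerian_poly n) (- s * r ^ n) / ((real m + 1) * r ^ m) ^ n)
    \<longlonglongrightarrow> (- s) ^ (m - 1) * (1 - s)"
proof -
  define q where "q = (real m + 1) * r ^ m"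
  have r: "0 < r" "r < 1" using assms by auto
  have q: "0 < q" using r by (simp add: q_def)
  let ?t = "\<lambda>n j. real_of_int (eulerian n j) * (- s) ^ j * (r ^ n) ^ j / q ^ n"
  have main: "(\<lambda>n. ?t n j) \<longlonglongrightarrow> (- s) ^ j" if "q = (real j + 1) * r ^ j" for j
  proof -
    have "?t n j = (- s) ^ j * (real_of_int (eulerian n j) / (real j + 1) ^ n)" for n
      using r by (simp add: that power_mult_distrib mult.commute flip: power_mult)
    then show ?thesis
      using tendsto_mult_left[OF eulerian_asymp[of j], of "(- s) ^ j"] by simp
  qed
  have "(\<lambda>n. ?t n (m - 1) + ?t n m + (\<Sum>j\<in>{..<n} - {m - 1, m}. ?t n j))
      \<longlonglongrightarrow> (- s) ^ (m - 1) + (- s) ^ m + 0"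
    using peak_term[OF assms(1)] assms(1) r q
    by (intro tendsto_add main eulerian_tail_tendsto_0) (auto simp: q_def r_def of_nat_diff)
  also have "(- s) ^ (m - 1) + (- s) ^ m + 0 = (- s) ^ (m - 1) * (1 - s)"
    using assms(1) by (cases m) (auto simp: algebra_simps)
  finally show ?thesis
    unfolding q_def[symmetric]
  proof (rule Lim_transform_eventually)
    show "\<forall>\<^sub>F n in sequentially. ?t n (m - 1) + ?t n m + (\<Sum>j\<in>{..<n} - {m - 1, m}. ?t n j) =
        poly (eulerian_poly n) (- s * r ^ n) / q ^ n"
      \<comment> \<open>For \<open>n > m\<close> both peak indices occur in the sum.\<close>
      using eventually_gt_at_top[of m]
    proof eventually_elim
      case (elim n)
      have "poly (eulerian_poly n) (- s * r ^ n) / q ^ n = (\<Sum>j<n. ?t n j)"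
        by (simp only: poly_eulerian_poly sum_divide_distrib power_mult_distrib mult.assoc)
      also have "\<dots> = (\<Sum>j\<in>{..<n} - {m - 1, m}. ?t n j) + (\<Sum>j\<in>{m - 1, m}. ?t n j)"
        using elim by (intro sum.subset_diff) auto
      finally show ?case using assms(1) by simp
    qed
  qed
qed

text \<open>Pulling out \<open>fact m\<close> leaves a binomial weight, which is at most
  \<open>2 ^ j\<close>. For \<open>j < m\<close> the weight is 0, so the truncated exponent
  \<open>j - m\<close> is harmless.\<close>

lemma higher_pderiv_monom_binomial:
  fixes c :: "'a :: field_char_0"
  shows "(pderiv ^^ m) (monom c j) = monom (fact m * of_nat (j choose m) * c) (j - m)"
proof (rule poly_eqI)
  fix k
  have "of_nat (k + m choose m) = pochhammer (of_nat (Suc k) :: 'a) m / fact m"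
    unfolding binomial_gbinomial gbinomial_pochhammer' by (simp add: add.commute)
  then show "coeff ((pderiv ^^ m) (monom c j)) k =
      coeff (monom (fact m * of_nat (j choose m) * c) (j - m)) k"
    by (auto simp: coeff_higher_pderiv binomial_eq_0)
qed

text \<open>Differentiation kills the terms below \<open>m\<close> and turns term \<open>m\<close>
  into a constant of order \<open>(m + 1) ^ n\<close>; the terms above \<open>m\<close> are
  negligible against it by the tail estimate.\<close>

lemma higher_pderiv_eulerian_poly_pos:
  fixes m :: nat
  assumes "1 \<le> m"
  defines "r \<equiv> real m / real (m + 1)"
  shows "\<forall>\<^sub>F n in sequentially. \<forall>x. \<bar>x\<bar> \<le> 2 * r ^ n \<longrightarrow> 0 < poly ((pderiv ^^ m) (eulerian_poly n)) x"
proof -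
  define q where "q = (real m + 1) * r ^ m"
  have r: "0 < r" "r < 1" using assms by auto
  have q: "0 < q" using r by (simp add: q_def)
  \<comment> \<open>The constant 4 is a factor 2 from the binomial weight times the factor 2 in the
    radius.\<close>
  let ?R = "\<lambda>n. \<Sum>j\<in>{..<n} - {m - 1, m}. real_of_int (eulerian n j) * 4 ^ j * (r ^ n) ^ j / q ^ n"
  have "?R \<longlonglongrightarrow> 0"
    using peak_term[OF assms(1)] r q
    by (intro eulerian_tail_tendsto_0) (auto simp: q_def r_def)
  then have "\<forall>\<^sub>F n in sequentially. ?R n < 1 / 2"
    by (intro order_tendstoD) auto
  moreover have "\<forall>\<^sub>F n in sequentially. 1 / 2 < real_of_int (eulerian n m) / (real m + 1) ^ n"
    using eulerian_asymp[of m] by (intro order_tendstoD) auto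
  ultimately show ?thesis
    using eventually_gt_at_top[of m]
  proof (eventually_elim, intro allI impI)
    case (elim n)
    fix x assume x: "\<bar>x\<bar> \<le> 2 * r ^ n"
    let ?b = "\<lambda>j. real (j choose m) * real_of_int (eulerian n j) * x ^ (j - m)"
    have expand: "poly ((pderiv ^^ m) (eulerian_poly n)) x = fact m * (\<Sum>j<n. ?b j)"
      by (simp add: eulerian_poly_def higher_pderiv_sum higher_pderiv_monom_binomial poly_sum
          poly_monom sum_distrib_left mult.assoc)
    have "(\<Sum>j<n. ?b j) = (\<Sum>j\<in>{..<n} - {m - 1, m}. ?b j) + (\<Sum>j\<in>{m - 1, m}. ?b j)"
      using elim(3) by (intro sum.subset_diff) auto
    also have "(\<Sum>j\<in>{m - 1, m}. ?b j) = real_of_int (eulerian n m)"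
      using assms(1) by (simp add: binomial_eq_0)
    finally have split: "(\<Sum>j<n. ?b j) = (\<Sum>j\<in>{..<n} - {m - 1, m}. ?b j) + real_of_int (eulerian n m)" .
    have "\<bar>\<Sum>j\<in>{..<n} - {m - 1, m}. ?b j\<bar> \<le> (\<Sum>j\<in>{..<n} - {m - 1, m}. \<bar>?b j\<bar>)"
      by (rule sum_abs)
    also have "\<dots> \<le> (\<Sum>j\<in>{..<n} - {m - 1, m}.
        (real m + 1) ^ n * (real_of_int (eulerian n j) * 4 ^ j * (r ^ n) ^ j / q ^ n))"
    proof (rule sum_mono)
      fix j assume "j \<in> {..<n} - {m - 1, m}"
      show "\<bar>?b j\<bar> \<le> (real m + 1) ^ n * (real_of_int (eulerian n j) * 4 ^ j * (r ^ n) ^ j / q ^ n)"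
      proof (cases "m \<le> j")
        case True
        have "real (j choose m) \<le> 2 ^ j"
          using binomial_le_pow2[of j m] by (metis of_nat_le_iff of_nat_numeral of_nat_power)
        then have "\<bar>?b j\<bar> \<le> 2 ^ j * real_of_int (eulerian n j) * (2 * r ^ n) ^ (j - m)"
          using x eulerian_nonneg[of n j] unfolding abs_mult power_abs
          by (intro mult_mono power_mono) auto
        also have "\<dots> \<le> 2 ^ j * real_of_int (eulerian n j) * (2 ^ j * (r ^ n) ^ (j - m))"
          using r eulerian_nonneg[of n j] unfolding power_mult_distrib
          by (intro mult_left_mono mult_right_mono power_increasing) auto
        also have "\<dots> = real_of_int (eulerian n j) * 4 ^ j * (r ^ n) ^ (j - m)"
          by (simp add: mult_ac flip: power_mult_distrib)
        \<comment> \<open>Since \<open>q ^ n\<close> is \<open>(m + 1) ^ n\<close> times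
          \<open>(r ^ n) ^ m\<close>, the lost factor \<open>(r ^ n) ^ m\<close> becomes the
          normalisation by \<open>q ^ n\<close>.\<close>
        also have "(r ^ n) ^ (j - m) = (real m + 1) ^ n * ((r ^ n) ^ j / q ^ n)"
        proof -
          have "(r ^ n) ^ j = (r ^ n) ^ (j - m) * (r ^ n) ^ m"
            using True by (simp flip: power_add)
          moreover have "q ^ n = (real m + 1) ^ n * (r ^ n) ^ m"
            by (simp add: q_def power_mult_distrib mult.commute flip: power_mult)
          ultimately show ?thesis using r by simp
        qed
        finally show ?thesis by (simp add: mult_ac)
      next
        case False
        then show ?thesis using r q eulerian_nonneg[of n j] by (simp add: binomial_eq_0)
      qed
    qed
    also have "\<dots> = (real m + 1) ^ n * ?R n" by (simp add: sum_distrib_left)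
    also have "\<dots> < (real m + 1) ^ n * (1 / 2)"
      using elim(1) by (intro mult_strict_left_mono) auto
    also have "\<dots> < real_of_int (eulerian n m)"
      using elim(2) by (simp add: field_simps)
    finally have "0 < (\<Sum>j<n. ?b j)" unfolding split by linarith
    then show "0 < poly ((pderiv ^^ m) (eulerian_poly n)) x" unfolding expand by simp
  qed
qed

section \<open>Counting real roots and reading off their position in the list\<close>

lemma Rolle_poly_roots:
  fixes p :: "real poly" and S :: "real set"
  assumes "finite S" "S \<noteq> {}" "\<And>x. x \<in> S \<Longrightarrow> poly p x = 0"
  shows "\<exists>T. finite T \<and> Suc (card T) = card S \<and> T \<subseteq> {Min S..Max S} \<and>
    (\<forall>x\<in>T. poly (pderiv p) x = 0)"
  using assms
proof (induction S rule: finite_linorder_max_induct)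
  case (insert b A)
  show ?case
  proof (cases "A = {}")
    case False
    then obtain T where T: "finite T" "Suc (card T) = card A" "T \<subseteq> {Min A..Max A}"
      "\<forall>x\<in>T. poly (pderiv p) x = 0"
      using insert by auto
    have lt: "Max A < b" and "poly p (Max A) = 0" "poly p b = 0"
      using insert False by auto
    then obtain z where z: "Max A < z" "z < b" "poly (pderiv p) z = 0"
      using poly_MVT[of "Max A" b p] by auto
    have ends: "Min (insert b A) = Min A" "Max (insert b A) = b"
    proof -
      have "Min A \<le> Max A" using insert.hyps(1) False by simp
      then show "Min (insert b A) = Min A" "Max (insert b A) = b"
        using insert.hyps(1) False lt by (simp_all add: Min_insert Max_insert del: Min_le_iff)
    qed
    \<comment> \<open>The containment of \<open>T\<close> in the hull of \<open>A\<close> is carried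
      through the induction for this: the new zero lies to the right of the hull.\<close>
    have "z \<notin> T" using T(3) z(1) by auto
    then have "finite (insert z T)" "Suc (card (insert z T)) = card (insert b A)"
      using T insert.hyps by auto
    moreover have "insert z T \<subseteq> {Min (insert b A)..Max (insert b A)}"
    proof -
      have "Min A \<le> Max A" using insert.hyps(1) False by simp
      then show ?thesis using T(3) z lt unfolding ends by auto
    qed
    ultimately show ?thesis using T(4) z(3) by (intro exI[of _ "insert z T"]) auto
  qed (auto intro: exI[of _ "{}"])
qed simp

text \<open>Each differentiation loses at most one zero and, by Rolle, the zeros kept stay inside
  the interval; after \<open>m\<close> steps none may be left.\<close>

lemma card_roots_le_if_higher_pderiv_nonzero:
  fixes p :: "real poly"
  assumes "\<And>x. a < x \<Longrightarrow> x < b \<Longrightarrow> poly ((pderiv ^^ m) p) x \<noteq> 0"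
    and "finite S" "S \<subseteq> {a<..<b}" "\<And>x. x \<in> S \<Longrightarrow> poly p x = 0"
  shows "card S \<le> m"
  using assms
proof (induction m arbitrary: p S)
  case 0
  then have "S = {}" by (force simp: subset_iff)
  then show ?case by simp
next
  case (Suc m)
  show ?case
  proof (cases "S = {}")
    case False
    then obtain T where T: "finite T" "Suc (card T) = card S" "T \<subseteq> {Min S..Max S}"
      "\<forall>x\<in>T. poly (pderiv p) x = 0"
      using Rolle_poly_roots Suc.prems by metis
    have "Min S \<in> S" "Max S \<in> S" using Suc.prems(2) False by auto
    then have "T \<subseteq> {a<..<b}" using T(3) Suc.prems(3) by fastforce
    moreover have "(pderiv ^^ m) (pderiv p) = (pderiv ^^ Suc m) p" by (simp add: funpow_swap1)
    ultimately have "card T \<le> m"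
      using T Suc.prems(1) by (intro Suc.IH[of "pderiv p"]) auto
    then show ?thesis using T(2) by simp
  qed simp
qed

text \<open>In a strictly decreasing list the entries before \<open>z\<close> are exactly the larger
  elements. This reduces \<open>eulerian_zero\<close> to counting zeros.\<close>

lemma rev_sorted_list_of_set_nth:
  fixes Z :: "'a :: linorder set"
  assumes "finite Z" "z \<in> Z"
  shows "rev (sorted_list_of_set Z) ! card {x\<in>Z. z < x} = z"
proof -
  define ys where "ys = rev (sorted_list_of_set Z)"
  have ys: "set ys = Z" "distinct ys" "sorted_wrt (>) ys"
    using assms(1) sorted_list_of_set.strict_sorted_key_list_of_set[of Z]
    by (auto simp: ys_def sorted_wrt_rev)
  obtain i where i: "i < length ys" "ys ! i = z"
    using assms(2) ys(1) by (metis in_set_conv_nth)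
  have "{x\<in>Z. z < x} = (!) ys ` {..<i}"
  proof (intro equalityI subsetI)
    fix x assume "x \<in> {x\<in>Z. z < x}"
    then obtain k where k: "k < length ys" "ys ! k = x" "z < x"
      using ys(1) by (auto simp: in_set_conv_nth)
    then have "k < i"
      using i sorted_wrt_nth_less[OF ys(3), of i k] by (metis linorder_cases order_less_asym)
    then show "x \<in> (!) ys ` {..<i}" using k by auto
  next
    fix x assume "x \<in> (!) ys ` {..<i}"
    then show "x \<in> {x\<in>Z. z < x}"
      using i sorted_wrt_nth_less[OF ys(3), of _ i] ys(1) by (auto intro!: nth_mem)
  qed
  moreover have "inj_on ((!) ys) {..<i}"
    using ys(2) i(1) by (auto simp: inj_on_def nth_eq_iff_index_eq)
  ultimately have "card {x\<in>Z. z < x} = i" by (simp add: card_image)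
  then show ?thesis using i(2) by (simp add: ys_def)
qed

section \<open>Locating the zeros\<close>

lemma eulerian_poly_root_near:
  fixes k :: nat and \<delta> :: real
  assumes "1 \<le> k" "0 < \<delta>" "\<delta> < 1"
  defines "r \<equiv> real k / real (k + 1)"
  shows "\<forall>\<^sub>F n in sequentially. \<exists>z. - (1 + \<delta>) * r ^ n < z \<and> z < - (1 - \<delta>) * r ^ n \<and>
    poly (eulerian_poly n) z = 0"
proof -
  define q where "q = (real k + 1) * r ^ k"
  have r: "0 < r" using assms by simp
  have q: "0 < q" using r by (simp add: q_def)
  let ?f = "\<lambda>s n. poly (eulerian_poly n) (- s * r ^ n) / q ^ n"
  let ?L = "\<lambda>s :: real. (- s) ^ (k - 1) * (1 - s)"
  have "(\<lambda>n. ?f (1 + \<delta>) n * ?f (1 - \<delta>) n) \<longlonglongrightarrow> ?L (1 + \<delta>) * ?L (1 - \<delta>)"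
    unfolding q_def r_def by (intro tendsto_mult eulerian_poly_near_zero assms)
  \<comment> \<open>The product of the two limits is negative for either parity of
    \<open>k - 1\<close>, so no case split is needed to see the sign change.\<close>
  moreover have "?L (1 + \<delta>) * ?L (1 - \<delta>) = - (\<delta>\<^sup>2 * ((1 + \<delta>) * (1 - \<delta>)) ^ (k - 1))"
  proof -
    have "?L (1 + \<delta>) * ?L (1 - \<delta>) = - (\<delta>\<^sup>2 * ((- (1 + \<delta>)) * (- (1 - \<delta>))) ^ (k - 1))"
      unfolding power_mult_distrib by (simp add: power2_eq_square)
    then show ?thesis by (simp only: minus_mult_minus)
  qed
  moreover have "0 < \<delta>\<^sup>2 * ((1 + \<delta>) * (1 - \<delta>)) ^ (k - 1)" using assms by simp
  ultimately have "\<forall>\<^sub>F n in sequentially. ?f (1 + \<delta>) n * ?f (1 - \<delta>) n < 0"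
    by (intro order_tendstoD) auto
  then show ?thesis
  proof eventually_elim
    case (elim n)
    then have "poly (eulerian_poly n) (- (1 + \<delta>) * r ^ n) * poly (eulerian_poly n) (- (1 - \<delta>) * r ^ n) < 0"
      using q by (auto simp: mult_less_0_iff zero_less_divide_iff divide_less_0_iff)
    moreover have "- (1 + \<delta>) * r ^ n < - (1 - \<delta>) * r ^ n"
      using r assms(2) by (intro mult_strict_right_mono) auto
    ultimately show ?case using poly_IVT by blast
  qed
qed

text \<open>Disjoint intervals provide zeros \<open>z 1 > ... > z m\<close> above
  \<open>- 2 * r ^ n\<close>, and the derivative bound allows at most \<open>m\<close> there. Hence
  these are all of them, and \<open>z m\<close> is the \<open>m\<close>-th.\<close>

lemma eulerian_zero_near:
  fixes m :: nat and \<delta> :: real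
  assumes m: "1 \<le> m" and \<delta>: "0 < \<delta>" "\<delta> < 1"
  defines "r \<equiv> real m / real (m + 1)"
  shows "\<forall>\<^sub>F n in sequentially. - (1 + \<delta>) * r ^ n < eulerian_zero m n \<and>
    eulerian_zero m n < - (1 - \<delta>) * r ^ n"
proof -
  define \<rho> where "\<rho> k = real k / real (k + 1)" for k
  have roots: "\<forall>\<^sub>F n in sequentially. \<forall>k\<in>{1..m}. \<exists>z. - (1 + \<delta>) * \<rho> k ^ n < z \<and>
      z < - (1 - \<delta>) * \<rho> k ^ n \<and> poly (eulerian_poly n) z = 0"
    unfolding \<rho>_def using \<delta> by (intro eventually_ball_finite ballI eulerian_poly_root_near) auto
  have disjoint: "\<forall>\<^sub>F n in sequentially. \<forall>k\<in>{1..<m}. (1 + \<delta>) * \<rho> k ^ n < (1 - \<delta>) * \<rho> (Suc k) ^ n"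
  proof (intro eventually_ball_finite ballI)
    fix k assume "k \<in> {1..<m}"
    then have "0 < \<rho> k" "0 < \<rho> (Suc k)" "\<rho> k < \<rho> (Suc k)"
      by (auto simp: \<rho>_def field_simps)
    then have k: "0 < \<rho> k" "0 < \<rho> (Suc k)" "\<rho> k / \<rho> (Suc k) < 1"
      by simp_all
    then have "(\<lambda>n. (\<rho> k / \<rho> (Suc k)) ^ n) \<longlonglongrightarrow> 0"
      by (intro LIMSEQ_power_zero) auto
    \<comment> \<open>This is the separation of neighbouring intervals, divided by
      \<open>(1 + \<delta>) * \<rho> (Suc k) ^ n\<close>.\<close>
    then have "\<forall>\<^sub>F n in sequentially. (\<rho> k / \<rho> (Suc k)) ^ n < (1 - \<delta>) / (1 + \<delta>)"
      using \<delta> by (intro order_tendstoD) auto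
    then show "\<forall>\<^sub>F n in sequentially. (1 + \<delta>) * \<rho> k ^ n < (1 - \<delta>) * \<rho> (Suc k) ^ n"
      by eventually_elim (use k \<delta> in \<open>simp add: power_divide field_simps\<close>)
  qed simp
  show ?thesis
    using roots disjoint higher_pderiv_eulerian_poly_pos[OF m] eventually_ge_at_top[of 1]
  proof eventually_elim
    case (elim n)
    obtain z where z: "\<And>k. k \<in> {1..m} \<Longrightarrow> - (1 + \<delta>) * \<rho> k ^ n < z k \<and>
        z k < - (1 - \<delta>) * \<rho> k ^ n \<and> poly (eulerian_poly n) (z k) = 0"
      using elim(1) by metis
    have z_step: "z (Suc k) < z k" if "1 \<le> k" "Suc k \<le> m" for k
    proof -
      have "- (1 + \<delta>) * \<rho> k ^ n < z k" "z (Suc k) < - (1 - \<delta>) * \<rho> (Suc k) ^ n"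
        "(1 + \<delta>) * \<rho> k ^ n < (1 - \<delta>) * \<rho> (Suc k) ^ n"
        using z[of k] z[of "Suc k"] elim(2) that by auto
      then show ?thesis by linarith
    qed
    have anti: "z l < z k" if "1 \<le> k" "k < l" "l \<le> m" for k l
    proof -
      have "Suc k \<le> l" using that by simp
      then show ?thesis using that(1,3)
      proof (induction l rule: dec_induct)
        case (step i)
        then show ?case using z_step[of i] by simp
      qed (use z_step in simp)
    qed
    define Z where "Z = {x. poly (eulerian_poly n) x = 0}"
    \<comment> \<open>The factor 2 exceeds \<open>1 + \<delta>\<close>, so \<open>z m\<close> lies
      in this range.\<close>
    define U where "U = {x\<in>Z. - 2 * r ^ n < x}"
    have finZ: "finite Z" unfolding Z_def using elim(4) by (rule finite_eulerian_poly_roots)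
    have neg: "x < 0" if "x \<in> Z" for x
      using poly_eulerian_poly_pos[OF elim(4), of x] that by (force simp: Z_def)
    have inj: "inj_on z {1..m}"
      by (rule linorder_inj_onI) (use anti in \<open>force\<close>)+
    have zm: "- 2 * r ^ n < z m"
    proof -
      have "- 2 * r ^ n \<le> - (1 + \<delta>) * r ^ n" using \<delta> by (intro mult_right_mono) (auto simp: r_def)
      then show ?thesis using z[of m] m by (simp add: r_def \<rho>_def)
    qed
    have sub: "z ` {1..m} \<subseteq> U"
    proof (rule image_subsetI)
      fix k assume k: "k \<in> {1..m}"
      then have "z m \<le> z k" using anti[of k m] by (cases "k = m") auto
      then show "z k \<in> U" using z[OF k] zm by (auto simp: U_def Z_def)
    qed
    have "card U \<le> m"
    proof (rule card_roots_le_if_higher_pderiv_nonzero)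
      fix x assume "- 2 * r ^ n < x" "x < 0"
      then show "poly ((pderiv ^^ m) (eulerian_poly n)) x \<noteq> 0"
        using elim(3)[rule_format, of x] by (simp add: r_def)
    qed (use finZ neg in \<open>auto simp: U_def Z_def\<close>)
    moreover have "card (z ` {1..m}) = m" using inj by (simp add: card_image)
    ultimately have U: "U = z ` {1..m}"
      using sub finZ card_seteq[of U "z ` {1..m}"] by (auto simp: U_def)
    have "{x\<in>Z. z m < x} = {x\<in>U. z m < x}" using zm by (auto simp: U_def)
    also have "\<dots> = z ` {1..<m}"
      unfolding U using anti[of _ m] by (force simp: le_less)
    \<comment> \<open>Exactly the zero-based list index that \<open>eulerian_zero\<close>
      uses.\<close>
    finally have "card {x\<in>Z. z m < x} = m - 1"
      by (simp add: card_image inj_on_subset[OF inj] ivl_disj_un subset_iff)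
    then have "eulerian_zero m n = z m"
      using rev_sorted_list_of_set_nth[OF finZ, of "z m"] z[of m] m
      by (simp add: eulerian_zero_def Z_def)
    then show ?case using z[of m] m by (simp add: r_def \<rho>_def)
  qed
qed

theorem theorem1p2:
  fixes m :: nat
  assumes "m \<ge> 1"
  shows "(\<lambda>n. eulerian_zero m n / (- ((real m / real (m + 1)) ^ n))) \<longlonglongrightarrow> 1"
proof (rule tendstoI)
  fix \<epsilon> :: real assume \<epsilon>: "0 < \<epsilon>"
  \<comment> \<open>The cap \<open>1 / 2\<close> ensures \<open>\<delta> < 1\<close>, so that the
    interval around the zero stays negative.\<close>
  define \<delta> where "\<delta> = min \<epsilon> (1 / 2)"
  define r where "r = real m / real (m + 1)"
  have \<delta>: "0 < \<delta>" "\<delta> < 1" "\<delta> \<le> \<epsilon>" and r: "0 < r" using \<epsilon> assms by (auto simp: \<delta>_def r_def)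
  show "\<forall>\<^sub>F n in sequentially.
      dist (eulerian_zero m n / (- ((real m / real (m + 1)) ^ n))) 1 < \<epsilon>"
    using eulerian_zero_near[OF assms \<delta>(1,2)] unfolding r_def[symmetric]
  proof eventually_elim
    case (elim n)
    then have "1 - \<delta> < eulerian_zero m n / - (r ^ n)" "eulerian_zero m n / - (r ^ n) < 1 + \<delta>"
      using r by (auto simp: field_simps)
    then show ?case using \<delta>(3) unfolding dist_real_def by linarith
  qed
qed

end
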